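(* Let $A$ be an algebra, $\sigma$ an automorphism of $A$, and $\delta : A\to A$ a $\sigma$-derivation such that $\delta\circ\sigma=\sigma\circ\delta$. 1. The map $\sigma' : \Psi(A,\sigma,\delta)\to\Psi(A,\sigma,\delta)$ defined by $$\sigma'\Big(\sum_{n=-\infty}^N a_n\xi^n\Big)=\sum_{n=-\infty}^N\sigma(a_n)\xi^n$$ is an automorphism of the algebra $\Psi(A,\sigma,\delta)$ of formal twisted pseudodifferential symbols. 2. If $\tau : A \to \mathbb{C}$ is a trace on $A$ such that $\tau\circ\sigma=\tau$ and $\tau\circ\delta=0$, then the map $\mathrm{res}:\Psi(A,\sigma,\delta)\to\mathbb{C}$ defined by $$\mathrm{res}\Big(\sum_{n=-\infty}^N a_n\xi^n\Big)=\tau(a_{-1})$$ is a $\sigma'^{-1}$-trace on $\Psi(A,\sigma,\delta)$.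
   Context: Algebras are associative, unital, not necessarily commutative, over $\mathbb{C}$. A $\sigma$-derivation on $A$ is a linear map $\delta:A\to A$ with $\delta(ab)=\delta(a)b+\sigma(a)\delta(b)$ for all $a,b\in A$. For an automorphism $\theta$ of an algebra $B$, a $\theta$-trace on $B$ is a linear map $\varphi:B\to\mathbb{C}$ with $\varphi(xy)=\varphi(\theta(y)x)$ for all $x,y\in B$; a trace is the case $\theta=\mathrm{id}$. The algebra of formal twisted pseudodifferential symbols $\Psi(A,\sigma,\delta)$ is the set of all formal series $\sum_{n=-\infty}^{N} a_n\xi^n$ with $N\in\mathbb{Z}$, $a_n\in A$, an associative unital algebra with multiplication determined by the relations $\xi a-\sigma(a)\xi=\delta(a)$ for $a\in A$ and $\xi\xi^{-1}=\xi^{-1}\xi=1$. When $\delta\circ\sigma=\sigma\circ\delta$, this multiplication is given explicitly by $$\xi^n a=\sum_{j=0}^{\infty}\binom{n}{j}\delta^j(\sigma^{n-j}(a))\,\xi^{n-j},\qquad n\in\mathbb{Z},\ a\in A,$$ where $\binom{n}{j}=\frac{n(n-1)\cdots(n-j+1)}{j!}$, and the product of $\sum_n a_n\xi^n$ and $\sum_m b_m\xi^m$ is $\sum_{n,m}a_n(\xi^n b_m)\xi^m$. *)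

theory Defs
  imports Complex_Main
begin

text \<open>
  The product is an explicit parameter, since the product of twisted
  pseudodifferential symbols depends on \<open>\<sigma>\<close> and \<open>\<delta>\<close> and therefore cannot be given
  by a class instance. The case \<open>1 = 0\<close> is allowed.
\<close>

locale calgebra = vector_space scale
  for scale :: "complex \<Rightarrow> 'b::ab_group_add \<Rightarrow> 'b" +
  fixes mult :: "'b \<Rightarrow> 'b \<Rightarrow> 'b" and one :: 'b
  assumes mult_assoc: "mult (mult x y) z = mult x (mult y z)"
    and mult_one_left: "mult one x = x"
    and mult_one_right: "mult x one = x"
    and mult_add_left: "mult (x + y) z = mult x z + mult y z"
    and mult_add_right: "mult x (y + z) = mult x y + mult x z"
    and mult_scale_left: "mult (scale c x) y = scale c (mult x y)"
    and mult_scale_right: "mult x (scale c y) = scale c (mult x y)"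

locale calgebra_automorphism = calgebra scale mult one
  for scale :: "complex \<Rightarrow> 'b::ab_group_add \<Rightarrow> 'b" and mult one +
  fixes \<theta> :: "'b \<Rightarrow> 'b"
  assumes linear_auto: "Vector_Spaces.linear scale scale \<theta>"
    and auto_mult: "\<theta> (mult x y) = mult (\<theta> x) (\<theta> y)"
    and auto_one: "\<theta> one = one"
    and bij_auto: "bij \<theta>"

locale twisted_derivation = calgebra_automorphism scale mult one \<sigma>
  for scale :: "complex \<Rightarrow> 'b::ab_group_add \<Rightarrow> 'b" and mult one \<sigma> +
  fixes \<delta> :: "'b \<Rightarrow> 'b"
  assumes linear_deriv: "Vector_Spaces.linear scale scale \<delta>"
    and deriv_mult: "\<delta> (mult a b) = mult (\<delta> a) b + mult (\<sigma> a) (\<delta> b)"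

locale twisted_trace = calgebra_automorphism scale mult one \<theta>
  for scale :: "complex \<Rightarrow> 'b::ab_group_add \<Rightarrow> 'b" and mult one \<theta> +
  fixes \<phi> :: "'b \<Rightarrow> complex"
  assumes linear_trace: "Vector_Spaces.linear scale (*) \<phi>"
    and trace_twist: "\<phi> (mult x y) = \<phi> (mult (\<theta> y) x)"

abbreviation calgebra_trace ::
    "(complex \<Rightarrow> 'b::ab_group_add \<Rightarrow> 'b) \<Rightarrow> ('b \<Rightarrow> 'b \<Rightarrow> 'b) \<Rightarrow> 'b \<Rightarrow> ('b \<Rightarrow> complex) \<Rightarrow> bool"
  where "calgebra_trace scale mult one \<phi> \<equiv> twisted_trace scale mult one id \<phi>"

text \<open>
  A series \<open>\<Sum>n\<le>N. a\<^sub>n \<xi>\<^sup>n\<close> is represented by its coefficient function \<open>n \<mapsto> a\<^sub>n\<close>.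
\<close>

typedef (overloaded) 'a psym = "{f :: int \<Rightarrow> 'a::zero. \<exists>N. \<forall>n>N. f n = 0}"
  morphisms psym_coeff Abs_psym
  by auto

setup_lifting type_definition_psym

instantiation psym :: (ab_group_add) ab_group_add
begin

lift_definition zero_psym :: "'a psym" is "\<lambda>_. 0"
  by simp

lift_definition plus_psym :: "'a psym \<Rightarrow> 'a psym \<Rightarrow> 'a psym" is "\<lambda>f g n. f n + g n"
proof -
  fix f g :: "int \<Rightarrow> 'a"
  assume "\<exists>N. \<forall>n>N. f n = 0" and "\<exists>N. \<forall>n>N. g n = 0"
  then obtain N M where "\<forall>n>N. f n = 0" "\<forall>n>M. g n = 0"
    by blast
  then have "\<forall>n>max N M. f n + g n = 0"
    by simp
  then show "\<exists>N. \<forall>n>N. f n + g n = 0" ..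
qed

lift_definition uminus_psym :: "'a psym \<Rightarrow> 'a psym" is "\<lambda>f n. - f n"
  by simp

definition minus_psym :: "'a psym \<Rightarrow> 'a psym \<Rightarrow> 'a psym" where
  "minus_psym f g = f + - g"

instance
  by standard (simp_all add: minus_psym_def, (transfer, simp add: algebra_simps)+)

end

text \<open>
  Here and in \<open>psym_map\<close> the coefficient function is a symbol as soon as the maps applied
  to the coefficients send \<open>0\<close> to \<open>0\<close>, in particular when they are linear.
\<close>

definition psym_scale :: "(complex \<Rightarrow> 'a::zero \<Rightarrow> 'a) \<Rightarrow> complex \<Rightarrow> 'a psym \<Rightarrow> 'a psym" where
  "psym_scale scale c f = Abs_psym (\<lambda>n. scale c (psym_coeff f n))"

definition psym_map :: "('a::zero \<Rightarrow> 'a) \<Rightarrow> 'a psym \<Rightarrow> 'a psym" where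
  "psym_map \<sigma> f = Abs_psym (\<lambda>n. \<sigma> (psym_coeff f n))"

lift_definition psym_one :: "'a::{zero,one} psym" is "\<lambda>n. if n = 0 then 1 else 0"
  by (rule exI[of _ 0]) simp

definition funpow_int :: "('a \<Rightarrow> 'a) \<Rightarrow> int \<Rightarrow> 'a \<Rightarrow> 'a" where
  "funpow_int \<sigma> n = (if n \<ge> 0 then \<sigma> ^^ nat n else inv \<sigma> ^^ nat (- n))"

text \<open>
  \<open>xi_coeff scale \<sigma> \<delta> n a i\<close> is the coefficient of \<open>\<xi>\<^sup>i\<close> in \<open>\<xi>\<^sup>n a\<close>, that is, the summand
  with \<open>j = n - i\<close> of \<open>\<xi>\<^sup>n a = (\<Sum>j. (n choose j) \<delta>\<^sup>j(\<sigma>\<^sup>n\<^sup>-\<^sup>j(a)) \<xi>\<^sup>n\<^sup>-\<^sup>j)\<close>.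
\<close>

definition xi_coeff ::
    "(complex \<Rightarrow> 'a::zero \<Rightarrow> 'a) \<Rightarrow> ('a \<Rightarrow> 'a) \<Rightarrow> ('a \<Rightarrow> 'a) \<Rightarrow> int \<Rightarrow> 'a \<Rightarrow> int \<Rightarrow> 'a" where
  "xi_coeff scale \<sigma> \<delta> n a i =
     (if i \<le> n
      then scale (of_int n gchoose nat (n - i)) ((\<delta> ^^ nat (n - i)) (funpow_int \<sigma> i a))
      else 0)"

text \<open>
  The product is \<open>\<Sum>n m. a\<^sub>n (\<xi>\<^sup>n b\<^sub>m) \<xi>\<^sup>m\<close>. In the coefficient of \<open>\<xi>\<^sup>k\<close> only pairs with
  \<open>a\<^sub>n \<noteq> 0\<close>, \<open>b\<^sub>m \<noteq> 0\<close> and \<open>k \<le> n + m\<close> contribute, and these are finitely many because \<open>n\<close>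
  and \<open>m\<close> are bounded above.
\<close>

lift_definition psym_mult ::
    "(complex \<Rightarrow> 'a::{ring,monoid_mult} \<Rightarrow> 'a) \<Rightarrow> ('a \<Rightarrow> 'a) \<Rightarrow> ('a \<Rightarrow> 'a) \<Rightarrow>
     'a psym \<Rightarrow> 'a psym \<Rightarrow> 'a psym"
  is "\<lambda>scale \<sigma> \<delta> a b k.
        \<Sum>(n, m) \<in> {(n, m). a n \<noteq> 0 \<and> b m \<noteq> 0 \<and> k \<le> n + m}.
          a n * xi_coeff scale \<sigma> \<delta> n (b m) (k - m)"
proof -
  fix scale :: "complex \<Rightarrow> 'a \<Rightarrow> 'a" and \<sigma> \<delta> :: "'a \<Rightarrow> 'a" and a b :: "int \<Rightarrow> 'a"
  assume "\<exists>N. \<forall>n>N. a n = 0" and "\<exists>N. \<forall>n>N. b n = 0"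
  then obtain N M where "\<forall>n>N. a n = 0" "\<forall>n>M. b n = 0"
    by blast
  then have *: "{(n, m). a n \<noteq> 0 \<and> b m \<noteq> 0 \<and> k \<le> n + m} = {}" if "k > N + M" for k
    using that by (auto simp: not_less) (smt (verit))
  show "\<exists>K. \<forall>k>K. (\<Sum>(n, m) \<in> {(n, m). a n \<noteq> 0 \<and> b m \<noteq> 0 \<and> k \<le> n + m}.
          a n * xi_coeff scale \<sigma> \<delta> n (b m) (k - m)) = 0"
    by (intro exI[of _ "N + M"] allI impI) (simp only: * sum.empty)
qed

definition psym_res :: "('a::zero \<Rightarrow> complex) \<Rightarrow> 'a psym \<Rightarrow> complex" where
  "psym_res \<tau> f = \<tau> (psym_coeff f (- 1))"

end

theory Submission
  imports Defs "HOL-Computational_Algebra.Formal_Power_Series"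
begin

text \<open>
  Associativity of the symbol product reduces to \<open>\<xi>\<^sup>n (b (\<xi>\<^sup>m c)) = (\<xi>\<^sup>n b \<xi>\<^sup>m) c\<close> for coefficients
  \<open>b\<close>, \<open>c\<close>. This follows from the twisted Leibniz rule for \<open>\<xi>\<^sup>n (a b)\<close>, which rests on trinomial
  revision of binomial coefficients, and from \<open>\<xi>\<^sup>n (\<xi>\<^sup>m a) = \<xi>\<^sup>n\<^sup>+\<^sup>m a\<close>, which is Vandermonde's identity.
  The trace property is integration by parts, \<open>\<tau>(\<delta>\<^sup>j(a) b) = (-1)\<^sup>j \<tau>(\<sigma>\<^sup>j(a) \<delta>\<^sup>j(b))\<close>, where for
  \<open>j = n + m + 1\<close> the sign is absorbed by \<open>(n choose j) = (-1)\<^sup>j (m choose j)\<close>.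
\<close>

section \<open>Inverses and integer powers of automorphisms\<close>

lemma (in calgebra_automorphism) inverse_automorphism:
  "calgebra_automorphism scale mult one (inv \<theta>)"
proof -
  interpret \<theta>: Vector_Spaces.linear scale scale \<theta> by (rule linear_auto)
  have cancel: "\<theta> (inv \<theta> x) = x" for x
    using bij_auto by (simp add: bij_is_surj surj_f_inv_f)
  \<comment> \<open>Injectivity of \<theta> reduces every identity for \<open>inv \<theta>\<close>
    to its image under \<theta>, where \<open>cancel\<close> applies.\<close>
  have inj: "\<theta> x = \<theta> y \<Longrightarrow> x = y" for x y
    using bij_auto by (meson bij_is_inj injD)
  show ?thesis
  proof unfold_locales
    show "inv \<theta> (x + y) = inv \<theta> x + inv \<theta> y" for x y
      by (rule inj) (simp add: cancel \<theta>.add)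
    show "inv \<theta> (scale c x) = scale c (inv \<theta> x)" for c x
      by (rule inj) (simp add: cancel \<theta>.scale)
    show "inv \<theta> (mult x y) = mult (inv \<theta> x) (inv \<theta> y)" for x y
      by (rule inj) (simp add: cancel auto_mult)
    show "inv \<theta> one = one"
      by (rule inj) (simp add: cancel auto_one)
    show "bij (inv \<theta>)"
      using bij_auto by (rule bij_imp_bij_inv)
  qed
qed

lemma funpow_int_0 [simp]: "funpow_int f 0 x = x"
  by (simp add: funpow_int_def)

lemma funpow_int_1 [simp]: "funpow_int f 1 x = f x"
  by (simp add: funpow_int_def)

lemma funpow_int_minus1 [simp]: "funpow_int f (-1) x = inv f x"
  by (simp add: funpow_int_def)

lemma funpow_int_plus1:
  assumes "bij f"
  shows "funpow_int f (n + 1) x = f (funpow_int f n x)"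
proof (cases "n \<ge> 0")
  case True
  then have "nat (n + 1) = Suc (nat n)" by simp
  with True show ?thesis by (simp add: funpow_int_def)
next
  case False
  \<comment> \<open>For negative \<open>n\<close> the outer \<open>f\<close> cancels one of the
    \<open>nat (- n)\<close> copies of \<open>inv f\<close>.\<close>
  then have "nat (- n) = Suc (nat (- (n + 1)))" by simp
  with False assms show ?thesis
    by (auto simp add: funpow_int_def bij_is_surj surj_f_inv_f)
qed

lemma funpow_int_minus1_left:
  assumes "bij f"
  shows "funpow_int f (n - 1) x = inv f (funpow_int f n x)"
  using funpow_int_plus1[OF assms, of "n - 1" x] assms
  by (simp add: bij_is_inj inv_f_f)

lemma funpow_int_add:
  assumes "bij f"
  shows "funpow_int f (n + m) x = funpow_int f n (funpow_int f m x)"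
proof (induction n rule: int_induct[where k = 0])
  case base
  show ?case by simp
next
  case (step1 i)
  then show ?case
    using funpow_int_plus1[OF assms, of "i + m" x] funpow_int_plus1[OF assms, of i]
    by (simp add: algebra_simps)
next
  case (step2 i)
  then show ?case
    using funpow_int_minus1_left[OF assms, of "i + m" x] funpow_int_minus1_left[OF assms, of i]
    by (simp add: algebra_simps)
qed

text \<open>Commutation with \<open>f\<close> passes to \<open>inv f\<close>, since \<open>f\<close>
  sends both \<open>g (inv f x)\<close> and \<open>inv f (g x)\<close> to \<open>g x\<close>;
  negative powers follow.\<close>

lemma funpow_int_commute:
  assumes "bij f" and "\<And>x. g (f x) = f (g x)"
  shows "g (funpow_int f n x) = funpow_int f n (g x)"
proof -
  have inv: "g (inv f x) = inv f (g x)" for x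
  proof -
    have "f (g (inv f x)) = g x"
      using assms by (metis bij_is_surj surj_f_inv_f)
    then show ?thesis
      using assms(1) by (metis bij_is_inj inv_f_f)
  qed
  show ?thesis
  proof (induction n rule: int_induct[where k = 0])
    case base
    show ?case by simp
  next
    case (step1 i)
    then show ?case by (simp add: funpow_int_plus1 assms)
  next
    case (step2 i)
    then show ?case by (simp add: funpow_int_minus1_left assms(1) inv)
  qed
qed

section \<open>The twisted Leibniz rule for powers of \<delta>\<close>

text \<open>The sorts \<open>ring\<close> and \<open>monoid_mult\<close> are used in place of
  \<open>ring_1\<close>, whose axiom \<open>0 \<noteq> 1\<close> would exclude the zero
  algebra.\<close>

locale commuting_twisted_derivation = twisted_derivation scale "(*)" 1 \<sigma> \<delta>
  for scale :: "complex \<Rightarrow> 'a::{ring,monoid_mult} \<Rightarrow> 'a" and \<sigma> \<delta> :: "'a \<Rightarrow> 'a" +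
  assumes deriv_auto: "\<delta> (\<sigma> a) = \<sigma> (\<delta> a)"
begin

sublocale \<sigma>: Vector_Spaces.linear scale scale \<sigma> by (rule linear_auto)
sublocale \<delta>: Vector_Spaces.linear scale scale \<delta> by (rule linear_deriv)

abbreviation spow :: "int \<Rightarrow> 'a \<Rightarrow> 'a" where "spow \<equiv> funpow_int \<sigma>"
abbreviation xi :: "int \<Rightarrow> 'a \<Rightarrow> int \<Rightarrow> 'a" where "xi \<equiv> xi_coeff scale \<sigma> \<delta>"
abbreviation pmult :: "'a psym \<Rightarrow> 'a psym \<Rightarrow> 'a psym" where "pmult \<equiv> psym_mult scale \<sigma> \<delta>"

lemma deriv_one: "\<delta> 1 = 0"
  using deriv_mult[of 1 1] by (simp add: auto_one)

lemma deriv_pow_one: "(\<delta> ^^ Suc j) 1 = 0"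
  by (induction j) (simp_all add: deriv_one \<delta>.zero)

lemma linear_deriv_pow: "Vector_Spaces.linear scale scale (\<delta> ^^ j)"
  by unfold_locales (induction j; simp add: \<delta>.add \<delta>.scale)+

sublocale \<delta>p: Vector_Spaces.linear scale scale "\<delta> ^^ j" for j
  by (rule linear_deriv_pow)

lemma inv_auto:
  "inv \<sigma> (x + y) = inv \<sigma> x + inv \<sigma> y" "inv \<sigma> (scale c x) = scale c (inv \<sigma> x)"
  "inv \<sigma> (x * y) = inv \<sigma> x * inv \<sigma> y" "inv \<sigma> 1 = 1"
proof -
  interpret i: calgebra_automorphism scale "(*)" 1 "inv \<sigma>" by (rule inverse_automorphism)
  interpret i: Vector_Spaces.linear scale scale "inv \<sigma>" by (rule i.linear_auto)
  show "inv \<sigma> (x + y) = inv \<sigma> x + inv \<sigma> y" "inv \<sigma> (scale c x) = scale c (inv \<sigma> x)"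
    "inv \<sigma> (x * y) = inv \<sigma> x * inv \<sigma> y" "inv \<sigma> 1 = 1"
    by (simp_all add: i.add i.scale i.auto_mult i.auto_one)
qed

lemma inv_auto_zero: "inv \<sigma> 0 = 0"
  using inv_auto(1)[of 0 0] by simp

lemma spow_hom:
  "spow n (x + y) = spow n x + spow n y" "spow n (scale c x) = scale c (spow n x)"
  "spow n (x * y) = spow n x * spow n y" "spow n 1 = 1"
  by (induction n rule: int_induct[where k = 0];
      simp add: funpow_int_plus1 funpow_int_minus1_left bij_auto \<sigma>.add \<sigma>.scale auto_mult auto_one
        inv_auto)+

sublocale sp: Vector_Spaces.linear scale scale "spow n" for n
  by unfold_locales (simp_all add: spow_hom)

lemma deriv_pow_auto: "(\<delta> ^^ j) (\<sigma> a) = \<sigma> ((\<delta> ^^ j) a)"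
  by (induction j) (simp_all add: deriv_auto)

lemma deriv_pow_spow: "(\<delta> ^^ j) (spow n a) = spow n ((\<delta> ^^ j) a)"
  by (rule funpow_int_commute) (simp_all add: bij_auto deriv_pow_auto)

lemma deriv_spow: "\<delta> (spow n a) = spow n (\<delta> a)"
  by (rule funpow_int_commute) (simp_all add: bij_auto deriv_auto)

lemma spow_add: "spow n (spow m a) = spow (n + m) a"
  by (simp add: funpow_int_add bij_auto)

lemma spow_auto: "spow n (\<sigma> a) = \<sigma> (spow n a)"
  by (rule funpow_int_commute[symmetric]) (simp_all add: bij_auto)

text \<open>On products, \<delta> is the sum of two operators on pairs of factors: \<delta> on the
  left one alone, and \<sigma> on the left with \<delta> on the right. They commute because \<delta>
  and \<sigma> do, so the binomial theorem applies; the induction is Pascal's rule.\<close>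

lemma deriv_pow_mult:
  "(\<delta> ^^ i) (a * b) =
    (\<Sum>j\<le>i. scale (of_nat (i choose j)) ((\<delta> ^^ j) (spow (int i - int j) a) * (\<delta> ^^ (i - j)) b))"
proof (induction i)
  case 0
  show ?case by simp
next
  case (Suc i)
  let ?T = "\<lambda>j. (\<delta> ^^ j) (spow (int (Suc i) - int j) a) * (\<delta> ^^ (Suc i - j)) b"
  have step: "\<delta> ((\<delta> ^^ j) (spow (int i - int j) a) * (\<delta> ^^ (i - j)) b) = ?T (Suc j) + ?T j"
    if "j \<le> i" for j
  proof -
    have "\<sigma> ((\<delta> ^^ j) (spow (int i - int j) a)) = (\<delta> ^^ j) (spow (int (Suc i) - int j) a)"
      using funpow_int_plus1[OF bij_auto, of "int i - int j" a]
      by (simp add: deriv_pow_auto algebra_simps)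
    then show ?thesis
      using that by (simp add: deriv_mult Suc_diff_le)
  qed
  have "(\<delta> ^^ Suc i) (a * b) =
      (\<Sum>j\<le>i. scale (of_nat (i choose j)) (?T (Suc j) + ?T j))"
    by (simp add: Suc.IH \<delta>.sum \<delta>.scale step)
  also have "\<dots> = (\<Sum>j\<le>i. scale (of_nat (i choose j)) (?T (Suc j)))
      + (\<Sum>j\<le>i. scale (of_nat (i choose j)) (?T j))"
    by (simp add: scale_right_distrib sum.distrib)
  \<comment> \<open>The new term has coefficient \<open>i choose Suc i\<close>, which is 0; it
    aligns the range for the index shift.\<close>
  also have "(\<Sum>j\<le>i. scale (of_nat (i choose j)) (?T j)) =
      (\<Sum>j\<le>Suc i. scale (of_nat (i choose j)) (?T j))"
    by simp
  also have "\<dots> = ?T 0 + (\<Sum>j\<le>i. scale (of_nat (i choose Suc j)) (?T (Suc j)))"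
    by (subst sum.atMost_Suc_shift) simp
  also have "(\<Sum>j\<le>i. scale (of_nat (i choose j)) (?T (Suc j))) + \<dots> =
      ?T 0 + (\<Sum>j\<le>i. scale (of_nat (Suc i choose Suc j)) (?T (Suc j)))"
    by (simp add: scale_left_distrib sum.distrib)
  also have "\<dots> = (\<Sum>j\<le>Suc i. scale (of_nat (Suc i choose j)) (?T j))"
    by (subst sum.atMost_Suc_shift) simp
  finally show ?case .
qed

section \<open>Moving powers of \<xi> past coefficients\<close>

lemma xi_eq: "xi n a (n - int j) = scale (of_int n gchoose j) ((\<delta> ^^ j) (spow (n - int j) a))"
  by (simp add: xi_coeff_def)

lemma xi_above: "n < i \<Longrightarrow> xi n a i = 0"
  by (simp add: xi_coeff_def)

lemma linear_xi: "Vector_Spaces.linear scale scale (\<lambda>a. xi n a i)"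
  by unfold_locales
    (simp_all add: xi_coeff_def sp.add sp.scale \<delta>p.add \<delta>p.scale scale_right_distrib
      scale_left_commute)

sublocale xi: Vector_Spaces.linear scale scale "\<lambda>a. xi n a i" for n i
  by (rule linear_xi)

lemma xi_auto: "xi n (\<sigma> a) i = \<sigma> (xi n a i)"
  by (simp add: xi_coeff_def spow_auto deriv_pow_auto \<sigma>.scale \<sigma>.zero)

lemma xi_zero_left: "xi 0 a i = (if i = 0 then a else 0)"
  by (auto simp: xi_coeff_def gbinomial_0_left)

text \<open>All terms below the top one contain a positive power of \<delta> applied to 1.\<close>

lemma xi_one: "xi n 1 i = (if i = n then 1 else 0)"
proof (cases "i < n")
  case True
  then obtain j where "nat (n - i) = Suc j"
    by (metis Suc_pred zero_less_diff zero_less_nat_eq diff_gt_0_iff_gt)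
  then show ?thesis
    using True by (simp add: xi_coeff_def spow_hom deriv_pow_one del: funpow.simps)
next
  case False
  then show ?thesis by (auto simp: xi_coeff_def spow_hom)
qed

text \<open>Moving \<open>\<xi>\<^sup>n\<close> past \<open>a\<close> and then each resulting power
  past \<open>b\<close> must agree with moving it past \<open>a * b\<close>. After the Leibniz rule,
  the coefficients match by trinomial revision, (n choose i)(i choose j) = (n choose j)(n-j choose
  i-j).\<close>

lemma xi_mult:
  "xi n (a * b) (n - int i) =
    (\<Sum>j\<le>i. xi n a (n - int j) * xi (n - int j) b (n - int i))"
proof -
  have "xi n (a * b) (n - int i) = (\<Sum>j\<le>i. scale ((of_int n gchoose i) * of_nat (i choose j))
      ((\<delta> ^^ j) (spow (n - int j) a) * (\<delta> ^^ (i - j)) (spow (n - int i) b)))"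
    by (simp add: xi_eq spow_hom deriv_pow_mult spow_add scale_sum_right)
  also have "\<dots> = (\<Sum>j\<le>i. xi n a (n - int j) * xi (n - int j) b (n - int i))"
  proof (rule sum.cong[OF refl])
    fix j assume "j \<in> {..i}"
    then have j: "j \<le> i" by simp
    then have eq: "n - int i = (n - int j) - int (i - j)" by simp
    have "(of_int n gchoose i) * of_nat (i choose j) =
        ((of_int n :: complex) gchoose j) * (of_int (n - int j) gchoose (i - j))"
      using gbinomial_trinomial_revision[OF j, of "of_int n :: complex"]
      by (simp add: binomial_gbinomial)
    moreover have "xi (n - int j) b (n - int i) =
        scale (of_int (n - int j) gchoose (i - j)) ((\<delta> ^^ (i - j)) (spow (n - int i) b))"
      unfolding eq by (rule xi_eq)
    ultimately show "scale ((of_int n gchoose i) * of_nat (i choose j))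
        ((\<delta> ^^ j) (spow (n - int j) a) * (\<delta> ^^ (i - j)) (spow (n - int i) b)) =
        xi n a (n - int j) * xi (n - int j) b (n - int i)"
      by (simp add: xi_eq mult_scale_left mult_scale_right)
  qed
  finally show ?thesis .
qed

text \<open>Since \<delta> and \<sigma> commute, every summand is a multiple of the same element
  \<open>(\<delta> ^^ s) (spow (p + m - int s) a)\<close>; Vandermonde's identity adds up the
  scalars.\<close>

lemma xi_xi:
  "(\<Sum>k\<le>s. xi p (xi m a (m - int k)) (p - int (s - k))) = xi (p + m) a (p + m - int s)"
proof -
  have "xi p (xi m a (m - int k)) (p - int (s - k)) =
      scale ((of_int m gchoose k) * (of_int p gchoose (s - k)))
        ((\<delta> ^^ s) (spow (p + m - int s) a))"
    if "k \<le> s" for k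
  proof -
    have "(\<delta> ^^ (s - k)) (spow (p - int (s - k)) ((\<delta> ^^ k) (spow (m - int k) a))) =
        (\<delta> ^^ (s - k + k)) (spow (p - int (s - k) + (m - int k)) a)"
      by (simp only: funpow_add o_apply deriv_pow_spow[symmetric] spow_add)
    also have "p - int (s - k) + (m - int k) = p + m - int s"
      using that by simp
    also have "s - k + k = s"
      using that by simp
    finally show ?thesis
      by (simp only: xi_eq sp.scale \<delta>p.scale scale_scale mult.commute)
  qed
  then have "(\<Sum>k\<le>s. xi p (xi m a (m - int k)) (p - int (s - k))) =
      scale (\<Sum>k\<le>s. (of_int m gchoose k) * (of_int p gchoose (s - k)))
        ((\<delta> ^^ s) (spow (p + m - int s) a))"
    by (simp add: scale_sum_left)
  then show ?thesis
    using gbinomial_Vandermonde[of "of_int m :: complex" "of_int p" s]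
    by (simp only: xi_eq of_int_add add.commute atLeast0AtMost)
qed

text \<open>The coefficient form of \<open>(\<xi>\<^sup>n b \<xi>\<^sup>m) c = \<xi>\<^sup>n (b (\<xi>\<^sup>m c))\<close>.\<close>

lemma xi_assoc_nat:
  "(\<Sum>j\<le>s. xi n b (n - int j) * xi (n + m - int j) c (n + m - int s)) =
    (\<Sum>k\<le>s. xi n (b * xi m c (m - int k)) (n - int (s - k)))"
proof -
  have "(\<Sum>k\<le>s. xi n (b * xi m c (m - int k)) (n - int (s - k))) =
      (\<Sum>k\<le>s. \<Sum>j\<le>s - k. xi n b (n - int j) *
        xi (n - int j) (xi m c (m - int k)) (n - int (s - k)))"
    by (simp only: xi_mult)
  \<comment> \<open>Both double sums run over the triangle \<open>j + k \<le> s\<close>.\<close>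
  also have "\<dots> = (\<Sum>j\<le>s. \<Sum>k\<le>s - j. xi n b (n - int j) *
        xi (n - int j) (xi m c (m - int k)) (n - int (s - k)))"
    unfolding sum.Sigma[OF finite_atMost ballI[OF finite_atMost]]
    by (rule sum.reindex_bij_witness[where i = "\<lambda>(j, k). (k, j)" and j = "\<lambda>(j, k). (k, j)"]) auto
  also have "\<dots> = (\<Sum>j\<le>s. xi n b (n - int j) * xi (n + m - int j) c (n + m - int s))"
  proof (rule sum.cong[OF refl])
    fix j assume "j \<in> {..s}"
    then have j: "j \<le> s" by simp
    \<comment> \<open>For fixed \<open>j\<close> this is a coefficient of
      \<open>\<xi>\<^sup>n\<^sup>-\<^sup>j (\<xi>\<^sup>m c)\<close>, with degree drop
      \<open>s - j\<close>, so \<open>xi_xi\<close> collapses it.\<close>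
    have "(\<Sum>k\<le>s - j. xi (n - int j) (xi m c (m - int k)) (n - int (s - k))) =
        (\<Sum>k\<le>s - j. xi (n - int j) (xi m c (m - int k)) (n - int j - int (s - j - k)))"
      using j by (intro sum.cong refl arg_cong[where f = "xi _ _"]) auto
    also have "\<dots> = xi (n - int j + m) c (n - int j + m - int (s - j))"
      by (rule xi_xi)
    also have "\<dots> = xi (n + m - int j) c (n + m - int s)"
      using j by (intro arg_cong2[where f = "\<lambda>p. xi p c"]) auto
    finally show "(\<Sum>k\<le>s - j. xi n b (n - int j) *
        xi (n - int j) (xi m c (m - int k)) (n - int (s - k))) =
        xi n b (n - int j) * xi (n + m - int j) c (n + m - int s)"
      by (simp add: sum_distrib_left[symmetric])
  qed
  finally show ?thesis by simp
qed

text \<open>The index sets are arbitrary finite supersets of the supports, so that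
  \<open>pmult_assoc\<close> can use the same window for all exponents.\<close>

lemma xi_assoc:
  assumes "finite P" "{k - l..n + m} \<subseteq> P" and "finite Q" "{k - n..m + l} \<subseteq> Q"
  shows "(\<Sum>p\<in>P. xi n b (p - m) * xi p c (k - l)) =
    (\<Sum>q\<in>Q. xi n (b * xi m c (q - l)) (k - q))"
proof -
  \<comment> \<open>Above the interval the first factor vanishes, below it the second.\<close>
  have P: "(\<Sum>p\<in>P. xi n b (p - m) * xi p c (k - l)) =
      (\<Sum>p\<in>{k - l..n + m}. xi n b (p - m) * xi p c (k - l))"
    using assms by (intro sum.mono_neutral_right) (auto simp: xi_above)
  have Q: "(\<Sum>q\<in>Q. xi n (b * xi m c (q - l)) (k - q)) =
      (\<Sum>q\<in>{k - n..m + l}. xi n (b * xi m c (q - l)) (k - q))"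
    using assms by (intro sum.mono_neutral_right) (auto simp: xi_above xi.zero)
  show ?thesis
  proof (cases "k - l \<le> n + m")
    \<comment> \<open>Both intervals are empty.\<close>
    case False
    then show ?thesis unfolding P Q by simp
  next
    case True
    \<comment> \<open>\<open>s\<close> is the total degree lost; the substitutions are
      \<open>p = n + m - j\<close> and \<open>q = m + l - j\<close>.\<close>
    define s where "s = nat (n + m - (k - l))"
    have s: "k = n + m + l - int s"
      using True by (simp add: s_def)
    have "(\<Sum>p\<in>{k - l..n + m}. xi n b (p - m) * xi p c (k - l)) =
        (\<Sum>j\<le>s. xi n b (n - int j) * xi (n + m - int j) c (n + m - int s))"
      by (rule sum.reindex_bij_witness[where i = "\<lambda>j. n + m - int j" and j = "\<lambda>p. nat (n + m - p)"])
        (auto simp: s algebra_simps)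
    moreover have "(\<Sum>q\<in>{k - n..m + l}. xi n (b * xi m c (q - l)) (k - q)) =
        (\<Sum>j\<le>s. xi n (b * xi m c (m - int j)) (n - int (s - j)))"
      by (rule sum.reindex_bij_witness[where i = "\<lambda>j. m + l - int j" and j = "\<lambda>q. nat (m + l - q)"])
        (auto simp: s intro!: arg_cong2[where f = "xi n"])
    ultimately show ?thesis
      unfolding P Q by (simp add: xi_assoc_nat)
  qed
qed

section \<open>Coefficients of symbols and of their products\<close>

lemma psym_bounded: "\<exists>N. \<forall>n>N. psym_coeff f n = 0"
  using psym_coeff[of f] by simp

lemma coeff_scale [simp]: "psym_coeff (psym_scale scale c f) n = scale c (psym_coeff f n)"
proof -
  have "(\<lambda>n. scale c (psym_coeff f n)) \<in> {f. \<exists>N. \<forall>n>N. f n = 0}"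
    using psym_bounded[of f] by auto
  then show ?thesis by (simp add: psym_scale_def Abs_psym_inverse)
qed

text \<open>The condition on \<open>g\<close> keeps the image bounded above, so that
  \<open>Abs_psym\<close> is inverted by \<open>psym_coeff\<close>.\<close>

lemma coeff_map:
  assumes "g 0 = (0 :: 'a)"
  shows "psym_coeff (psym_map g f) n = g (psym_coeff f n)"
proof -
  have "(\<lambda>n. g (psym_coeff f n)) \<in> {f. \<exists>N. \<forall>n>N. f n = 0}"
    using psym_bounded[of f] assms by simp metis
  then show ?thesis by (simp add: psym_map_def Abs_psym_inverse)
qed

lemma coeff_map_auto [simp]: "psym_coeff (psym_map \<sigma> f) n = \<sigma> (psym_coeff f n)"
  by (simp add: coeff_map \<sigma>.zero)

lemma coeff_add [simp]: "psym_coeff (f + g) n = psym_coeff f n + psym_coeff (g :: 'a psym) n"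
  by (simp add: plus_psym.rep_eq)

lemma coeff_one: "psym_coeff (psym_one :: 'a psym) n = (if n = 0 then 1 else 0)"
  by (simp add: psym_one.rep_eq)

lemma psym_eqI: "(\<And>n. psym_coeff f n = psym_coeff g n) \<Longrightarrow> f = g"
  by (simp add: psym_coeff_inject[symmetric] ext)

text \<open>
  The rectangle of summation may be chosen freely as long as it covers all contributing pairs,
  so that several products can be expanded over a common one.
\<close>

lemma coeff_mult:
  assumes "finite I" "finite J"
    and "\<And>n m. psym_coeff a n \<noteq> 0 \<Longrightarrow> psym_coeff b m \<noteq> 0 \<Longrightarrow> k \<le> n + m \<Longrightarrow> n \<in> I \<and> m \<in> J"
  shows "psym_coeff (pmult a b) k =
    (\<Sum>n\<in>I. \<Sum>m\<in>J. psym_coeff a n * xi n (psym_coeff b m) (k - m))"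
proof -
  have "psym_coeff (pmult a b) k =
      (\<Sum>(n, m)\<in>I \<times> J. psym_coeff a n * xi n (psym_coeff b m) (k - m))"
    unfolding psym_mult.rep_eq
  proof (intro sum.mono_neutral_left ballI)
    fix z assume z: "z \<in> I \<times> J - {(n, m). psym_coeff a n \<noteq> 0 \<and> psym_coeff b m \<noteq> 0 \<and> k \<le> n + m}"
    obtain n m where nm: "z = (n, m)" by fastforce
    with z consider "psym_coeff a n = 0" | "psym_coeff b m = 0" | "n < k - m" by fastforce
    then show "(case z of (n, m) \<Rightarrow> psym_coeff a n * xi n (psym_coeff b m) (k - m)) = 0"
      by cases (simp_all add: nm xi.zero xi_above)
  qed (use assms in auto)
  then show ?thesis by (simp add: sum.cartesian_product)
qed

text \<open>Upper bounds \<open>N\<close> and \<open>M\<close> together with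
  \<open>k \<le> n + m\<close> force the lower bounds \<open>k - M\<close> and
  \<open>k - N\<close>.\<close>

lemma coeff_mult_bounded:
  assumes "\<And>n. n > N \<Longrightarrow> psym_coeff a n = 0" and "\<And>m. m > M \<Longrightarrow> psym_coeff b m = 0"
    and "i \<le> k - M" "N \<le> i'" "j \<le> k - N" "M \<le> j'"
  shows "psym_coeff (pmult a b) k =
    (\<Sum>n=i..i'. \<Sum>m=j..j'. psym_coeff a n * xi n (psym_coeff b m) (k - m))"
proof (rule coeff_mult)
  fix n m assume "psym_coeff a n \<noteq> 0" "psym_coeff b m \<noteq> 0" "k \<le> n + m"
  with assms(1)[of n] assms(2)[of m] have "n \<le> N" "m \<le> M" by force+
  with \<open>k \<le> n + m\<close> assms(3-) show "n \<in> {i..i'} \<and> m \<in> {j..j'}" by auto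
qed auto

lemma mult_bounded:
  assumes "\<And>n. n > N \<Longrightarrow> psym_coeff a n = 0" and "\<And>m. m > M \<Longrightarrow> psym_coeff b m = 0"
    and "k > N + M"
  shows "psym_coeff (pmult a b) k = 0"
  \<comment> \<open>With the tightest window the range \<open>{k - M..N}\<close> is empty.\<close>
  using coeff_mult_bounded[where N = N and M = M and i = "k - M" and i' = N and j = "k - N" and j' = M,
      OF assms(1,2)] assms(3) by simp

lemma common_bound:
  obtains B where "\<And>n. n > B \<Longrightarrow> psym_coeff a n = 0" "\<And>n. n > B \<Longrightarrow> psym_coeff b n = 0"
    "\<And>n. n > B \<Longrightarrow> psym_coeff c n = 0"
proof -
  obtain N M L where "\<forall>n>N. psym_coeff a n = 0" "\<forall>n>M. psym_coeff b n = 0"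
      "\<forall>n>L. psym_coeff c n = 0"
    using psym_bounded[of a] psym_bounded[of b] psym_bounded[of c] by blast
  then show ?thesis by (intro that[of "max N (max M L)"]) auto
qed

section \<open>The algebra of symbols\<close>

lemma pmult_assoc: "pmult (pmult a b) c = pmult a (pmult b c)"
proof (rule psym_eqI)
  fix k
  obtain B where a: "\<And>n. n > B \<Longrightarrow> psym_coeff a n = 0"
    and b: "\<And>n. n > B \<Longrightarrow> psym_coeff b n = 0" and c: "\<And>n. n > B \<Longrightarrow> psym_coeff c n = 0"
    using common_bound[of a b c] by metis
  \<comment> \<open>\<open>?P\<close> holds the indices of the inner products, of degree at most
    \<open>2 * B\<close>; \<open>?I\<close> holds those of single factors, its lower end being
    uniform over all indices in \<open>?P\<close>.\<close>
  let ?I = "{k - 2 * B..B}" and ?P = "{k - B..2 * B}"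
  let ?a = "psym_coeff a" and ?b = "psym_coeff b" and ?c = "psym_coeff c"
  have ab: "\<And>n. n > 2 * B \<Longrightarrow> psym_coeff (pmult a b) n = 0"
    and bc: "\<And>n. n > 2 * B \<Longrightarrow> psym_coeff (pmult b c) n = 0"
    using mult_bounded[OF a b] mult_bounded[OF b c] by simp_all
  have "psym_coeff (pmult (pmult a b) c) k =
      (\<Sum>p\<in>?P. \<Sum>l\<in>?I. psym_coeff (pmult a b) p * xi p (?c l) (k - l))"
    by (rule coeff_mult_bounded[OF ab c]) auto
  also have "\<dots> = (\<Sum>p\<in>?P. \<Sum>l\<in>?I. (\<Sum>n\<in>?I. \<Sum>m\<in>?I. ?a n * xi n (?b m) (p - m)) * xi p (?c l) (k - l))"
    by (intro sum.cong refl arg_cong2[where f = "(*)"] coeff_mult_bounded[OF a b]) auto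
  also have "\<dots> = (\<Sum>p\<in>?P. \<Sum>l\<in>?I. \<Sum>n\<in>?I. \<Sum>m\<in>?I. ?a n * (xi n (?b m) (p - m) * xi p (?c l) (k - l)))"
    by (simp add: sum_distrib_right mult.assoc)
  \<comment> \<open>The sum over \<open>p\<close> is moved innermost, where \<open>n\<close>,
    \<open>m\<close>, \<open>l\<close> are fixed and \<open>xi_assoc\<close> trades it for a sum
    over \<open>q\<close>.\<close>
  also have "\<dots> = (\<Sum>l\<in>?I. \<Sum>n\<in>?I. \<Sum>m\<in>?I. \<Sum>p\<in>?P. ?a n * (xi n (?b m) (p - m) * xi p (?c l) (k - l)))"
    by (subst sum.swap, rule sum.cong[OF refl], subst sum.swap, rule sum.cong[OF refl], rule sum.swap)
  also have "\<dots> = (\<Sum>l\<in>?I. \<Sum>n\<in>?I. \<Sum>m\<in>?I. ?a n * (\<Sum>p\<in>?P. xi n (?b m) (p - m) * xi p (?c l) (k - l)))"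
    by (simp add: sum_distrib_left)
  also have "\<dots> = (\<Sum>l\<in>?I. \<Sum>n\<in>?I. \<Sum>m\<in>?I. ?a n * (\<Sum>q\<in>?P. xi n (?b m * xi m (?c l) (q - l)) (k - q)))"
    by (intro sum.cong refl arg_cong2[where f = "(*)"] xi_assoc) auto
  also have "\<dots> = (\<Sum>l\<in>?I. \<Sum>n\<in>?I. \<Sum>m\<in>?I. \<Sum>q\<in>?P. ?a n * xi n (?b m * xi m (?c l) (q - l)) (k - q))"
    by (simp add: sum_distrib_left)
  \<comment> \<open>Now \<open>q\<close> moves outside \<open>m\<close> and \<open>l\<close>, so
    that linearity of \<open>xi\<close> collects a coefficient of \<open>pmult b c\<close>.\<close>
  also have "\<dots> = (\<Sum>n\<in>?I. \<Sum>l\<in>?I. \<Sum>m\<in>?I. \<Sum>q\<in>?P. ?a n * xi n (?b m * xi m (?c l) (q - l)) (k - q))"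
    by (rule sum.swap)
  also have "\<dots> = (\<Sum>n\<in>?I. \<Sum>q\<in>?P. \<Sum>m\<in>?I. \<Sum>l\<in>?I. ?a n * xi n (?b m * xi m (?c l) (q - l)) (k - q))"
    by (rule sum.cong[OF refl], subst sum.swap, subst (2) sum.swap, subst sum.swap,
        rule sum.cong[OF refl], rule sum.cong[OF refl], rule refl)
  also have "\<dots> = (\<Sum>n\<in>?I. \<Sum>q\<in>?P. ?a n * xi n (\<Sum>m\<in>?I. \<Sum>l\<in>?I. ?b m * xi m (?c l) (q - l)) (k - q))"
    by (simp add: sum_distrib_left xi.sum)
  also have "\<dots> = (\<Sum>n\<in>?I. \<Sum>q\<in>?P. ?a n * xi n (psym_coeff (pmult b c) q) (k - q))"
    by (intro sum.cong refl arg_cong2[where f = "(*)"] arg_cong[where f = "\<lambda>x. xi _ x _"]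
        coeff_mult_bounded[OF b c, symmetric]) auto
  also have "\<dots> = psym_coeff (pmult a (pmult b c)) k"
    by (rule coeff_mult_bounded[OF a bc, symmetric]) auto
  finally show "psym_coeff (pmult (pmult a b) c) k = psym_coeff (pmult a (pmult b c)) k" .
qed

lemma pmult_one_left: "pmult psym_one b = b"
proof (rule psym_eqI)
  fix k
  obtain B where b: "\<And>n. n > B \<Longrightarrow> psym_coeff b n = 0"
    using psym_bounded[of b] by blast
  \<comment> \<open>Inserting \<open>k\<close> keeps the index set nonempty for
    \<open>k > B\<close>, where the selected coefficient is 0.\<close>
  have "psym_coeff (pmult psym_one b) k = (\<Sum>n\<in>{0}. \<Sum>m\<in>insert k {k..B}.
      psym_coeff psym_one n * xi n (psym_coeff b m) (k - m))"
    by (rule coeff_mult) (auto simp: coeff_one not_less split: if_splits intro: leI dest: b)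
  also have "\<dots> = (\<Sum>m\<in>insert k {k..B}. if k = m then psym_coeff b m else 0)"
    by (auto simp: coeff_one xi_zero_left intro!: sum.cong)
  also have "\<dots> = psym_coeff b k"
    by (subst sum.delta') auto
  finally show "psym_coeff (pmult psym_one b) k = psym_coeff b k" .
qed

lemma pmult_one_right: "pmult a psym_one = a"
proof (rule psym_eqI)
  fix k
  obtain B where a: "\<And>n. n > B \<Longrightarrow> psym_coeff a n = 0"
    using psym_bounded[of a] by blast
  have "psym_coeff (pmult a psym_one) k = (\<Sum>n\<in>insert k {k..B}. \<Sum>m\<in>{0}.
      psym_coeff a n * xi n (psym_coeff psym_one m) (k - m))"
    by (rule coeff_mult) (auto simp: coeff_one not_less split: if_splits intro: leI dest: a)
  also have "\<dots> = (\<Sum>n\<in>insert k {k..B}. if k = n then psym_coeff a n else 0)"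
    by (intro sum.cong) (auto simp: coeff_one xi_one)
  also have "\<dots> = psym_coeff a k"
    by (subst sum.delta') auto
  finally show "psym_coeff (pmult a psym_one) k = psym_coeff a k" .
qed

text \<open>A window depending only on \<open>B\<close> and \<open>k\<close> lets both sides of an
  identity be compared term by term.\<close>

lemma coeff_mult_square:
  assumes "\<And>n. n > B \<Longrightarrow> psym_coeff a n = 0" and "\<And>n. n > B \<Longrightarrow> psym_coeff b n = 0"
  shows "psym_coeff (pmult a b) k =
    (\<Sum>n=k - B..B. \<Sum>m=k - B..B. psym_coeff a n * xi n (psym_coeff b m) (k - m))"
  by (rule coeff_mult_bounded[OF assms]) auto

lemma calgebra_psym: "calgebra (psym_scale scale) pmult psym_one"
proof unfold_locales
  fix c d and x y z :: "'a psym"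
  show "psym_scale scale c (x + y) = psym_scale scale c x + psym_scale scale c y"
    "psym_scale scale (c + d) x = psym_scale scale c x + psym_scale scale d x"
    "psym_scale scale c (psym_scale scale d x) = psym_scale scale (c * d) x"
    "psym_scale scale 1 x = x"
    by (rule psym_eqI, simp add: scale_right_distrib scale_left_distrib)+
  show "pmult (pmult x y) z = pmult x (pmult y z)"
    "pmult psym_one x = x" "pmult x psym_one = x"
    by (rule pmult_assoc pmult_one_left pmult_one_right)+
  show "pmult (x + y) z = pmult x z + pmult y z"
  proof (rule psym_eqI)
    fix k
    obtain B where B: "\<And>n. n > B \<Longrightarrow> psym_coeff x n = 0" "\<And>n. n > B \<Longrightarrow> psym_coeff y n = 0"
      "\<And>n. n > B \<Longrightarrow> psym_coeff z n = 0"
      using common_bound[of x y z] by metis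
    then show "psym_coeff (pmult (x + y) z) k = psym_coeff (pmult x z + pmult y z) k"
      by (simp add: coeff_mult_square[of B] distrib_right sum.distrib)
  qed
  show "pmult x (y + z) = pmult x y + pmult x z"
  proof (rule psym_eqI)
    fix k
    obtain B where B: "\<And>n. n > B \<Longrightarrow> psym_coeff x n = 0" "\<And>n. n > B \<Longrightarrow> psym_coeff y n = 0"
      "\<And>n. n > B \<Longrightarrow> psym_coeff z n = 0"
      using common_bound[of x y z] by metis
    then show "psym_coeff (pmult x (y + z)) k = psym_coeff (pmult x y + pmult x z) k"
      by (simp add: coeff_mult_square[of B] distrib_left sum.distrib xi.add)
  qed
  show "pmult (psym_scale scale c x) y = psym_scale scale c (pmult x y)"
    "pmult x (psym_scale scale c y) = psym_scale scale c (pmult x y)"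
  proof (rule_tac [!] psym_eqI)
    fix k
    obtain B where B: "\<And>n. n > B \<Longrightarrow> psym_coeff x n = 0" "\<And>n. n > B \<Longrightarrow> psym_coeff y n = 0"
      using common_bound[of x y y] by metis
    show "psym_coeff (pmult (psym_scale scale c x) y) k = psym_coeff (psym_scale scale c (pmult x y)) k"
      "psym_coeff (pmult x (psym_scale scale c y)) k = psym_coeff (psym_scale scale c (pmult x y)) k"
      by (simp_all add: coeff_mult_square[of B] B scale_sum_right mult_scale_left mult_scale_right xi.scale)
  qed
qed

section \<open>The coefficientwise automorphism\<close>

lemma psym_map_inverse:
  "psym_map \<sigma> (psym_map (inv \<sigma>) f) = f" "psym_map (inv \<sigma>) (psym_map \<sigma> f) = f"
  using bij_auto
  by (auto intro!: psym_eqI simp: coeff_map inv_auto_zero bij_is_surj surj_f_inv_f bij_is_inj)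

text \<open>Multiplicativity rests on \<open>xi_auto\<close>: \<sigma> commutes with \<delta> and
  with its own powers, hence with every coefficient map of \<open>\<xi>\<^sup>n\<close>.\<close>

lemma automorphism_psym_map:
  "calgebra_automorphism (psym_scale scale) pmult psym_one (psym_map \<sigma>)"
proof -
  interpret P: calgebra "psym_scale scale" pmult psym_one by (rule calgebra_psym)
  show ?thesis
  proof unfold_locales
    fix c and x y :: "'a psym"
    show "psym_map \<sigma> (x + y) = psym_map \<sigma> x + psym_map \<sigma> y"
      "psym_map \<sigma> (psym_scale scale c x) = psym_scale scale c (psym_map \<sigma> x)"
      "psym_map \<sigma> psym_one = psym_one"
      by (rule psym_eqI, simp add: \<sigma>.add \<sigma>.scale \<sigma>.zero coeff_one auto_one)+
    show "psym_map \<sigma> (pmult x y) = pmult (psym_map \<sigma> x) (psym_map \<sigma> y)"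
    proof (rule psym_eqI)
      fix k
      obtain B where B: "\<And>n. n > B \<Longrightarrow> psym_coeff x n = 0" "\<And>n. n > B \<Longrightarrow> psym_coeff y n = 0"
      using common_bound[of x y y] by metis
      have "psym_coeff (psym_map \<sigma> (pmult x y)) k =
          \<sigma> (\<Sum>n=k - B..B. \<Sum>m=k - B..B. psym_coeff x n * xi n (psym_coeff y m) (k - m))"
        by (simp add: coeff_mult_square[of B] B)
      also have "\<dots> = (\<Sum>n=k - B..B. \<Sum>m=k - B..B. \<sigma> (psym_coeff x n) * xi n (\<sigma> (psym_coeff y m)) (k - m))"
        by (simp only: \<sigma>.sum auto_mult xi_auto)
      also have "\<dots> = psym_coeff (pmult (psym_map \<sigma> x) (psym_map \<sigma> y)) k"
        by (simp add: coeff_mult_square[of B] B \<sigma>.zero)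
      finally show "psym_coeff (psym_map \<sigma> (pmult x y)) k =
          psym_coeff (pmult (psym_map \<sigma> x) (psym_map \<sigma> y)) k" .
    qed
    show "bij (psym_map \<sigma>)"
      by (rule o_bij[where g = "psym_map (inv \<sigma>)"]) (simp_all add: fun_eq_iff psym_map_inverse)
  qed
qed

text \<open>Expresses the twist through \<open>inv \<sigma>\<close> on coefficients, the form that
  \<open>trace_xi\<close> handles.\<close>

lemma inv_psym_map: "inv (psym_map \<sigma>) = psym_map (inv \<sigma>)"
  by (rule inv_equality) (simp_all add: psym_map_inverse)

section \<open>The residue as a twisted trace\<close>

context
  fixes \<tau> :: "'a \<Rightarrow> complex"
  assumes trace: "calgebra_trace scale (*) 1 \<tau>"
    and trace_auto: "\<tau> (\<sigma> a) = \<tau> a" and trace_deriv: "\<tau> (\<delta> a) = 0"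
begin

interpretation \<tau>: twisted_trace scale "(*)" 1 id \<tau> by (rule trace)
interpretation \<tau>l: Vector_Spaces.linear scale "(*)" \<tau> by (rule \<tau>.linear_trace)

lemma trace_spow: "\<tau> (spow n a) = \<tau> a"
proof (induction n rule: int_induct[where k = 0])
  case base
  show ?case by simp
next
  case (step1 i)
  then show ?case by (simp add: funpow_int_plus1 bij_auto trace_auto)
next
  case (step2 i)
  then show ?case
    using funpow_int_plus1[OF bij_auto, of "i - 1" a] trace_auto[of "spow (i - 1) a"] by simp
qed

text \<open>Each step expands \<tau>(\<delta>(u v)) = 0 by the twisted product rule, which moves one
  \<delta> across at the cost of a sign and a \<sigma>. The induction varies \<open>a\<close>
  because one \<delta> is absorbed into it first.\<close>

lemma trace_by_parts: "\<tau> ((\<delta> ^^ j) a * b) = (-1) ^ j * \<tau> (spow (int j) a * (\<delta> ^^ j) b)"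
proof (induction j arbitrary: a)
  case 0
  show ?case by simp
next
  case (Suc j)
  have "\<tau> ((\<delta> ^^ Suc j) a * b) = (-1) ^ j * \<tau> (spow (int j) (\<delta> a) * (\<delta> ^^ j) b)"
    using Suc.IH[of "\<delta> a"] by (simp add: funpow_swap1)
  also have "\<tau> (spow (int j) (\<delta> a) * (\<delta> ^^ j) b) = - \<tau> (\<sigma> (spow (int j) a) * \<delta> ((\<delta> ^^ j) b))"
    using trace_deriv[of "spow (int j) a * (\<delta> ^^ j) b"]
    by (simp add: deriv_mult \<tau>l.add deriv_spow eq_neg_iff_add_eq_0)
  also have "\<sigma> (spow (int j) a) = spow (int (Suc j)) a"
    using funpow_int_plus1[OF bij_auto, of "int j" a] by (simp add: add.commute)
  finally show ?case by simp
qed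

text \<open>The trace identity for the monomials \<open>a \<xi>\<^sup>n\<close> and
  \<open>b \<xi>\<^sup>m\<close>, from which the general case follows by summation.\<close>

lemma trace_xi:
  "\<tau> (a * xi n b (- 1 - m)) = \<tau> (inv \<sigma> b * xi m a (- 1 - n))"
proof (cases "n + m + 1 \<ge> 0")
  case False
  \<comment> \<open>Both requested coefficients lie above the top degrees \<open>n\<close> and
    \<open>m\<close>.\<close>
  then show ?thesis by (simp add: xi_above)
next
  case True
  \<comment> \<open>\<open>j\<close> counts the applications of \<delta> on either side.\<close>
  define j where "j = nat (n + m + 1)"
  then have n: "n = int j - 1 - m" and m: "-1 - m = n - int j" "-1 - n = m - int j"
    using True by auto
  have "\<tau> (inv \<sigma> b * xi m a (- 1 - n)) =
      (of_int m gchoose j) * \<tau> (inv \<sigma> b * (\<delta> ^^ j) (spow (m - int j) a))"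
    by (simp add: m xi_eq mult_scale_right \<tau>l.scale)
  also have "\<tau> (inv \<sigma> b * (\<delta> ^^ j) (spow (m - int j) a)) =
      \<tau> ((\<delta> ^^ j) (spow (m - int j) a) * inv \<sigma> b)"
    using \<tau>.trace_twist[of "inv \<sigma> b"] by simp
  also have "\<dots> = (-1) ^ j * \<tau> (spow m a * (\<delta> ^^ j) (spow (-1) b))"
    by (simp add: trace_by_parts spow_add)
  \<comment> \<open>A common \<open>spow m\<close> is factored out so that invariance of \<tau>
    removes it.\<close>
  also have "\<tau> (spow m a * (\<delta> ^^ j) (spow (-1) b)) =
      \<tau> (spow m (a * (\<delta> ^^ j) (spow (-1 - m) b)))"
    by (simp add: spow_hom deriv_pow_spow[symmetric] spow_add)
  also have "\<dots> = \<tau> (a * (\<delta> ^^ j) (spow (n - int j) b))"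
    by (simp add: trace_spow m)
  \<comment> \<open>Negating the upper index turns \<open>n\<close> into \<open>j - n - 1\<close>,
    which is \<open>m\<close>; its sign cancels the one from integration by parts.\<close>
  also have "(of_int m gchoose j) * ((-1) ^ j * \<dots>) =
      (of_int n gchoose j) * \<tau> (a * (\<delta> ^^ j) (spow (n - int j) b))"
    using gbinomial_negated_upper[of "of_int n :: complex" j]
    by (simp add: n)
  also have "\<dots> = \<tau> (a * xi n b (- 1 - m))"
    by (simp add: m xi_eq mult_scale_right \<tau>l.scale)
  finally show ?thesis by simp
qed

lemma twisted_trace_res:
  "twisted_trace (psym_scale scale) pmult psym_one (inv (psym_map \<sigma>)) (psym_res \<tau>)"
proof -
  interpret S: calgebra_automorphism "psym_scale scale" pmult psym_one "psym_map \<sigma>"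
    by (rule automorphism_psym_map)
  interpret S': calgebra_automorphism "psym_scale scale" pmult psym_one "inv (psym_map \<sigma>)"
    by (rule S.inverse_automorphism)
  show ?thesis
  proof unfold_locales
    fix c and x y :: "'a psym"
    show "psym_res \<tau> (x + y) = psym_res \<tau> x + psym_res \<tau> y"
      "psym_res \<tau> (psym_scale scale c x) = c * psym_res \<tau> x"
      by (simp_all add: psym_res_def \<tau>l.add \<tau>l.scale)
    obtain B where B: "\<And>n. n > B \<Longrightarrow> psym_coeff x n = 0" "\<And>n. n > B \<Longrightarrow> psym_coeff y n = 0"
      using common_bound[of x y y] by metis
    have "psym_res \<tau> (pmult x y) =
        (\<Sum>n\<in>{- 1 - B..B}. \<Sum>m\<in>{- 1 - B..B}. \<tau> (psym_coeff x n * xi n (psym_coeff y m) (- 1 - m)))"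
      by (simp add: psym_res_def coeff_mult_square[of B] B \<tau>l.sum)
    also have "\<dots> = (\<Sum>m\<in>{- 1 - B..B}. \<Sum>n\<in>{- 1 - B..B}. \<tau> (inv \<sigma> (psym_coeff y m) * xi m (psym_coeff x n) (- 1 - n)))"
      by (subst sum.swap) (intro sum.cong refl trace_xi)
    also have "\<dots> = psym_res \<tau> (pmult (inv (psym_map \<sigma>) y) x)"
      \<comment> \<open>The bound \<open>B\<close> still serves for the twisted \<open>y\<close>,
        because \<open>inv \<sigma>\<close> fixes 0.\<close>
      by (simp add: psym_res_def coeff_mult_square[of B] B \<tau>l.sum inv_psym_map coeff_map inv_auto_zero)
    finally show "psym_res \<tau> (pmult x y) = psym_res \<tau> (pmult (inv (psym_map \<sigma>) y) x)" .
  qed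
qed

end

end

theorem proposition3p5:
  fixes scale :: "complex \<Rightarrow> 'a::{ring,monoid_mult} \<Rightarrow> 'a"
    and \<sigma> \<delta> :: "'a \<Rightarrow> 'a"
  assumes "calgebra scale (*) 1"
    and "calgebra_automorphism scale (*) 1 \<sigma>"
    and "twisted_derivation scale (*) 1 \<sigma> \<delta>"
    and "\<delta> \<circ> \<sigma> = \<sigma> \<circ> \<delta>"
  shows "calgebra_automorphism (psym_scale scale) (psym_mult scale \<sigma> \<delta>) psym_one (psym_map \<sigma>)
    \<and> (\<forall>\<tau> :: 'a \<Rightarrow> complex.
         calgebra_trace scale (*) 1 \<tau> \<longrightarrow> \<tau> \<circ> \<sigma> = \<tau> \<longrightarrow> \<tau> \<circ> \<delta> = (\<lambda>_. 0) \<longrightarrow>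
         twisted_trace (psym_scale scale) (psym_mult scale \<sigma> \<delta>) psym_one
           (inv (psym_map \<sigma>)) (psym_res \<tau>))"
proof -
  interpret twisted_derivation scale "(*)" 1 \<sigma> \<delta> by (rule assms(3))
  interpret commuting_twisted_derivation scale \<sigma> \<delta>
    using assms(4) by unfold_locales (simp add: fun_eq_iff)
  show ?thesis
  proof (intro conjI allI impI)
    show "calgebra_automorphism (psym_scale scale) (psym_mult scale \<sigma> \<delta>) psym_one (psym_map \<sigma>)"
      by (rule automorphism_psym_map)
    fix \<tau> :: "'a \<Rightarrow> complex"
    assume "calgebra_trace scale (*) 1 \<tau>" and "\<tau> \<circ> \<sigma> = \<tau>" and "\<tau> \<circ> \<delta> = (\<lambda>_. 0)"
    then show "twisted_trace (psym_scale scale) (psym_mult scale \<sigma> \<delta>) psym_one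
        (inv (psym_map \<sigma>)) (psym_res \<tau>)"
      by (intro twisted_trace_res) (metis comp_apply)+
  qed
qed

end
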